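(* If $n>1$ is an integer, then, as an identity of rational functions in the variables $x_1,\ldots,x_{2n}$, $$s(x_1,\ldots,x_{2n})=(-1)^nT_n.$$
   Context: Let $S_{2n}$ be the symmetric group on $\{1,\ldots,2n\}$, let $x_1,\ldots,x_{2n}$ be independent variables, and let $C(2n)$ be the set of all $2n$-cycles in $S_{2n}$, i.e. permutations of the form $(a_1\ a_2\ \ldots\ a_{2n})$ with $\{a_1,\ldots,a_{2n}\}=\{1,\ldots,2n\}$. Define $$s(x_1,\ldots,x_{2n})=\sum_{\tau\in C(2n)}\ \prod_{\substack{1\le j\le 2n\\ \tau(j)\neq j}}\frac{x_j+x_{\tau(j)}}{x_j-x_{\tau(j)}}.$$ The tangent numbers $T_n$ ($n=1,2,3,\ldots$) are defined by $\tan x=\sum_{n=1}^\infty T_n\frac{x^{2n-1}}{(2n-1)!}$ for $|x|<\pi/2$. *)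

theory Defs
  imports
    "HOL-Complex_Analysis.Complex_Analysis"
    "HOL-Combinatorics.Cycles"
    "HOL-Library.Poly_Mapping"
    "HOL-Computational_Algebra.Fraction_Field"
begin

section \<open>Tangent numbers\<close>

definition tan_expansion :: "(nat \<Rightarrow> real) \<Rightarrow> bool" where
  "tan_expansion T \<longleftrightarrow> (\<forall>x::real. \<bar>x\<bar> < pi / 2 \<longrightarrow>
     (\<lambda>k. T (Suc k) * (x ^ (2 * Suc k - 1) / fact (2 * Suc k - 1))) sums tan x)"

text \<open>
  The expansion determines \<open>T n\<close> for \<open>n \<ge> 1\<close> and leaves \<open>T 0\<close> unconstrained; existence and
  uniqueness are proved below.
\<close>

definition tangent_number :: "nat \<Rightarrow> real" where
  "tangent_number = (SOME T. tan_expansion T)"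

lemma tan_expansion_exists: "\<exists>T. tan_expansion T"
proof -
  define c where "c = (\<lambda>n. Re (fps_nth (fps_tan (1::complex)) n))"
  have c: "(\<lambda>n. c n * x ^ n) sums tan x" if x: "\<bar>x\<bar> < pi / 2" for x :: real
  proof -
    have "ereal (norm (complex_of_real x)) < ereal (pi / (2 * norm (1::complex)))"
      using x by simp
    also have "\<dots> \<le> fps_conv_radius (fps_tan (1::complex))"
      using fps_conv_radius_tan[of "1::complex"] by simp
    finally have "(\<lambda>n. fps_nth (fps_tan (1::complex)) n * of_real x ^ n) sums
        eval_fps (fps_tan 1) (of_real x)"
      unfolding eval_fps_def by (intro summable_sums summable_fps) auto
    moreover have "eval_fps (fps_tan (1::complex)) (of_real x) = of_real (tan x)"
      using x eval_fps_tan[where c = "1::complex" and z = "of_real x"]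
      by (simp add: tan_of_real)
    ultimately have "(\<lambda>n. Re (fps_nth (fps_tan (1::complex)) n * of_real x ^ n)) sums
        Re (of_real (tan x))"
      by (metis sums_Re)
    then show ?thesis
      by (simp add: c_def flip: of_real_power)
  qed
  have "tan_expansion (\<lambda>n. c (2 * n - 1) * fact (2 * n - 1))"
    unfolding tan_expansion_def
  proof (intro allI impI)
    fix x :: real
    assume x: "\<bar>x\<bar> < pi / 2"
    have "(\<lambda>n. (c n * x ^ n - c n * (- x) ^ n) / 2) sums ((tan x - tan (- x)) / 2)"
      using x by (intro sums_divide sums_diff c) auto
    also have "(\<lambda>n. (c n * x ^ n - c n * (- x) ^ n) / 2) = (\<lambda>n. if odd n then c n * x ^ n else 0)"
      by auto
    finally have "(\<lambda>n. if odd n then c n * x ^ n else 0) sums tan x"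
      by simp
    then have "(\<lambda>k. if odd (2 * k + 1) then c (2 * k + 1) * x ^ (2 * k + 1) else 0) sums tan x"
      by (subst sums_mono_reindex[where g = "\<lambda>k. 2 * k + 1"
            and f = "\<lambda>n. if odd n then c n * x ^ n else 0"])
         (auto simp: strict_mono_def elim!: oddE)
    then show "(\<lambda>k. c (2 * Suc k - 1) * fact (2 * Suc k - 1) *
        (x ^ (2 * Suc k - 1) / fact (2 * Suc k - 1))) sums tan x"
      by simp
  qed
  then show ?thesis by blast
qed

lemma tan_expansion_tangent_number: "tan_expansion tangent_number"
  unfolding tangent_number_def using tan_expansion_exists by (rule someI_ex)

lemma tan_expansion_unique:
  assumes T: "tan_expansion T" and n: "n \<ge> 1"
  shows "T n = fact (2 * n - 1) * fps_nth (fps_tan 1) (2 * n - 1)"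
proof -
  define d where "d = (\<lambda>m. if odd m then T (Suc m div 2) / fact m else 0)"
  have d: "(\<lambda>m. d m * x ^ m) sums tan x" if x: "\<bar>x\<bar> < pi / 2" for x :: real
  proof -
    have "(\<lambda>k. d (2 * k + 1) * x ^ (2 * k + 1)) sums tan x"
      using T x by (simp add: tan_expansion_def d_def)
    then show ?thesis
      by (subst (asm) sums_mono_reindex[where g = "\<lambda>k. 2 * k + 1" and f = "\<lambda>m. d m * x ^ m"])
         (auto simp: strict_mono_def d_def elim!: oddE)
  qed
  let ?F = "fps_tan 1 :: real fps"
  have F: "tan has_fps_expansion ?F"
    by (rule has_fps_expansion_tan')
  then have "\<forall>\<^sub>F x in nhds 0. eval_fps ?F x = tan x"
    by (simp add: has_fps_expansion_def)
  moreover have "\<forall>\<^sub>F x::real in nhds 0. ereal (norm x) < fps_conv_radius ?F"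
  proof -
    have "eball (0::real) (fps_conv_radius ?F) \<in> {S. open S \<and> 0 \<in> S}"
      using F by (auto simp: has_fps_expansion_def zero_ereal_def)
    then have "\<forall>\<^sub>F x::real in nhds 0. x \<in> eball 0 (fps_conv_radius ?F)"
      by (intro eventually_nhds_in_open) auto
    then show ?thesis by (rule eventually_mono) simp
  qed
  ultimately have "\<forall>\<^sub>F x in nhds 0. (\<lambda>m. fps_nth ?F m * x ^ m) sums tan x"
  proof eventually_elim
    case (elim x)
    then show ?case
      by (metis eval_fps_def summable_fps summable_sums)
  qed
  then obtain r where r: "r > 0" "\<And>x. \<bar>x\<bar> < r \<Longrightarrow> (\<lambda>m. fps_nth ?F m * x ^ m) sums tan x"
    by (auto simp: eventually_nhds_metric)
  define e where "e = (\<lambda>m. d m - fps_nth ?F m)"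
  have e: "(\<lambda>m. e m * (x - 0) ^ m) sums 0" if "norm (x - 0) < min r (pi / 2)" for x :: real
    using sums_diff[OF d r(2), of x x] that by (simp add: e_def algebra_simps)
  have "e (2 * n - 1) = 0"
  proof (rule ccontr)
    assume "e (2 * n - 1) \<noteq> 0"
    moreover have "0 < min r (pi / 2)" and "0 < 2 * n - 1"
      using r(1) n by auto
    ultimately obtain s :: real
      where s: "0 < s" "\<And>z::real. z \<in> cball 0 s - {0} \<Longrightarrow> (0::real) \<noteq> 0"
      using powser_0_nonzero[of "min r (pi / 2)" 0 e "\<lambda>_. 0" "2 * n - 1"] e by blast
    show False using s(1) s(2)[of s] by simp
  qed
  then have "fps_nth ?F (2 * n - 1) = d (2 * n - 1)"
    by (simp add: e_def)
  with n show ?thesis by (simp add: d_def)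
qed

section \<open>Rational functions\<close>

text \<open>
  Real polynomials in the variables \<open>x\<^sub>0, x\<^sub>1, x\<^sub>2, \<dots>\<close> are finitely supported families of
  coefficients indexed by exponent vectors. Every rational function in
  \<open>x\<^sub>1, \<dots>, x\<^sub>m\<close> lives in their common field of fractions.
\<close>

type_synonym polyfun = "(nat \<Rightarrow>\<^sub>0 nat) \<Rightarrow>\<^sub>0 real"
type_synonym ratfun = "polyfun fract"

definition indet :: "nat \<Rightarrow> ratfun" where
  "indet i = Fract (Poly_Mapping.single (Poly_Mapping.single i 1) 1) 1"

definition scalar :: "real \<Rightarrow> ratfun" where
  "scalar a = Fract (Poly_Mapping.single 0 a) 1"

section \<open>The sum over full cycles\<close>

definition full_cycles :: "nat \<Rightarrow> (nat \<Rightarrow> nat) set" where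
  "full_cycles m = {cycle_of_list as | as. distinct as \<and> set as = {1..m}}"

lemma finite_full_cycles: "finite (full_cycles m)"
proof (rule finite_subset)
  show "full_cycles m \<subseteq> {p. p permutes {1..m}}"
    unfolding full_cycles_def by clarify (metis cycle_permutes)
qed (simp add: finite_permutations)

definition cycle_sum :: "nat \<Rightarrow> (nat \<Rightarrow> 'a::field) \<Rightarrow> 'a" where
  "cycle_sum n x =
     (\<Sum>\<tau>\<in>full_cycles (2 * n). \<Prod>j\<in>{j \<in> {1..2 * n}. \<tau> j \<noteq> j}. (x j + x (\<tau> j)) / (x j - x (\<tau> j)))"

end

theory Submission
  imports Defs "HOL-Combinatorics.Multiset_Permutations"
begin

text \<open>
  The whole argument rests on a three-term identity for the ratios \<open>a u v = (u + v) / (u - v)\<close>,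
  \<open>a u y * a y v = a u v * (a u y - a v y) - 1\<close>.
  When \<open>y\<close> is inserted in all possible places of a path, the first summands telescope and only the
  cut paths survive; so the sum of path products over all orderings of an \<open>m\<close>-element set is an
  integer with a convolution recursion, whose exponential generating function is \<open>tanh\<close>.
  When \<open>y\<close> closes a path up to a cycle, the first summands cancel because the cyclic product is
  invariant under rotation; so the sum over \<open>2n\<close>-cycles is minus the path sum over
  \<open>2n - 1\<close> elements.
\<close>

section \<open>Path products\<close>

definition ratio :: "('i \<Rightarrow> 'a::field) \<Rightarrow> 'i \<Rightarrow> 'i \<Rightarrow> 'a" where
  "ratio x i j = (x i + x j) / (x i - x j)"

lemma ratio_swap: "ratio x j i = - ratio x i j"
  unfolding ratio_def by (metis add.commute minus_diff_eq minus_divide_right)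

text \<open>For \<open>x i = exp (2 * s)\<close> and \<open>x j = exp (2 * t)\<close> the ratio is
  coth (s - t), and this is the addition theorem of coth. Over a general field it follows by
  clearing denominators.\<close>

lemma ratio_three_term:
  assumes "x i \<noteq> x j" "x j \<noteq> x k" "x i \<noteq> x k"
  shows "ratio x i j * ratio x j k = ratio x i k * (ratio x i j + ratio x j k) - 1"
proof -
  have "x i - x j \<noteq> 0" "x j - x k \<noteq> 0" "x i - x k \<noteq> 0"
    using assms by auto
  then show ?thesis
    unfolding ratio_def by (simp add: divide_simps) (simp add: algebra_simps)
qed

text \<open>
  The value \<open>0\<close> on the empty path discards the splittings of a path with an empty part.
\<close>

fun path_prod :: "('i \<Rightarrow> 'a::field) \<Rightarrow> 'i list \<Rightarrow> 'a" where
  "path_prod x [] = 0"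
| "path_prod x [i] = 1"
| "path_prod x (i # j # js) = ratio x i j * path_prod x (j # js)"

lemma path_prod_append:
  "us \<noteq> [] \<Longrightarrow> vs \<noteq> [] \<Longrightarrow>
    path_prod x (us @ vs) = path_prod x us * ratio x (last us) (hd vs) * path_prod x vs"
proof (induction us)
  case (Cons u us)
  then show ?case
    by (cases us; cases vs) auto
qed simp

section \<open>Inserting a point into a path\<close>

definition splits :: "'i list \<Rightarrow> ('i list \<times> 'i list) set" where
  "splits zs = {(us, vs). us @ vs = zs}"

lemma splits_Nil: "splits [] = {([], [])}"
  by (auto simp: splits_def)

lemma splits_Cons: "splits (z # zs) = insert ([], z # zs) ((\<lambda>p. (z # fst p, snd p)) ` splits zs)"
  by (auto simp: splits_def Cons_eq_append_conv append_eq_Cons_conv image_iff)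

lemma finite_splits: "finite (splits zs)"
  by (induction zs) (auto simp: splits_Nil splits_Cons)

lemma sum_splits_Cons:
  "(\<Sum>p\<in>splits (z # zs). f p) = f ([], z # zs) + (\<Sum>p\<in>splits zs. f (z # fst p, snd p))"
proof -
  have inj: "inj_on (\<lambda>p. (z # fst p, snd p)) (splits zs)"
    by (auto simp: inj_on_def prod_eq_iff)
  show ?thesis
    unfolding splits_Cons
    by (subst sum.insert) (auto simp: finite_splits sum.reindex[OF inj])
qed

text \<open>Keeping the head \<open>z\<close> in front leaves a boundary term through which the
  induction telescopes. Inserting \<open>y\<close> right after \<open>z\<close> breaks the edge from
  \<open>z\<close> to \<open>w\<close>. Of the three terms given by \<open>ratio_three_term\<close>,
  one cancels the boundary term of the induction hypothesis, one is the new boundary term, and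
  \<open>- 1\<close> yields the path cut after \<open>z\<close>.\<close>

lemma sum_insertions_Cons:
  assumes "inj_on x (insert y (set (z # zs)))" "distinct (y # z # zs)"
  shows "(\<Sum>(us, vs)\<in>splits zs. path_prod x (z # us @ y # vs)) =
    ratio x z y * path_prod x (z # zs) - (\<Sum>(us, vs)\<in>splits zs. path_prod x (z # us) * path_prod x vs)"
  using assms
proof (induction zs arbitrary: z)
  case Nil
  show ?case by (simp add: splits_Nil)
next
  case (Cons w zs)
  have ne: "x z \<noteq> x y" "x y \<noteq> x w" "x z \<noteq> x w"
    using Cons.prems by (auto simp: inj_on_def)
  have IH: "(\<Sum>(us, vs)\<in>splits zs. path_prod x (w # us @ y # vs)) =
    ratio x w y * path_prod x (w # zs) - (\<Sum>(us, vs)\<in>splits zs. path_prod x (w # us) * path_prod x vs)"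
    using Cons.prems by (intro Cons.IH) (auto intro: inj_on_subset)
  have J: "(\<Sum>(us, vs)\<in>splits (w # zs). path_prod x (z # us @ y # vs)) =
      ratio x z y * ratio x y w * path_prod x (w # zs) +
      ratio x z w * (\<Sum>(us, vs)\<in>splits zs. path_prod x (w # us @ y # vs))"
    by (simp add: sum_splits_Cons sum_distrib_left case_prod_unfold mult.assoc)
  have K: "(\<Sum>(us, vs)\<in>splits (w # zs). path_prod x (z # us) * path_prod x vs) =
      path_prod x (w # zs) + ratio x z w * (\<Sum>(us, vs)\<in>splits zs. path_prod x (w # us) * path_prod x vs)"
    by (simp add: sum_splits_Cons sum_distrib_left case_prod_unfold mult.assoc)
  show ?case
    unfolding J K IH ratio_three_term[of x z y w, OF ne] ratio_swap[of x w y]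
    by (simp add: algebra_simps)
qed

text \<open>The one remaining place for \<open>y\<close>, before the head \<open>z\<close>,
  contributes \<open>ratio x y z\<close> times the whole path. By antisymmetry this cancels the
  boundary term.\<close>

lemma sum_insertions:
  assumes "inj_on x (insert y (set zs))" "distinct (y # zs)" "zs \<noteq> []"
  shows "(\<Sum>(us, vs)\<in>splits zs. path_prod x (us @ y # vs)) =
    - (\<Sum>(us, vs)\<in>splits zs. path_prod x us * path_prod x vs)"
proof -
  obtain z zs' where zs: "zs = z # zs'"
    using assms(3) by (cases zs) auto
  show ?thesis
    using sum_insertions_Cons[of x y z zs'] assms ratio_swap[of x z y]
    by (simp add: zs sum_splits_Cons case_prod_unfold)
qed

section \<open>Path sums\<close>

definition path_sum :: "('i \<Rightarrow> 'a::field) \<Rightarrow> 'i set \<Rightarrow> 'a" where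
  "path_sum x A = (\<Sum>zs\<in>permutations_of_set A. path_prod x zs)"

section \<open>Reindexing sums over orderings\<close>

lemma sum_permutations_splits:
  "(\<Sum>zs\<in>permutations_of_set A. sum f (splits zs)) = sum f {(us, vs). us @ vs \<in> permutations_of_set A}"
proof -
  have "sum f (\<Union>zs\<in>permutations_of_set A. splits zs) =
      (\<Sum>zs\<in>permutations_of_set A. sum f (splits zs))"
    by (rule sum.UNION_disjoint) (auto simp: finite_splits, auto simp: splits_def)
  also have "(\<Union>zs\<in>permutations_of_set A. splits zs) = {(us, vs). us @ vs \<in> permutations_of_set A}"
    by (auto simp: splits_def)
  finally show ?thesis by simp
qed

lemma sum_permutations_insert:
  assumes "y \<notin> A"
  shows "(\<Sum>ys\<in>permutations_of_set (insert y A). f ys) =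
    (\<Sum>zs\<in>permutations_of_set A. \<Sum>(us, vs)\<in>splits zs. f (us @ y # vs))"
proof -
  let ?S = "{(us, vs). us @ vs \<in> permutations_of_set A}"
  let ?h = "\<lambda>(us, vs). us @ y # vs"
  have bij: "bij_betw ?h ?S (permutations_of_set (insert y A))"
    unfolding bij_betw_def
  proof
    show "inj_on ?h ?S"
    proof (rule inj_onI, clarify)
      fix us vs us' vs'
      assume "us @ vs \<in> permutations_of_set A" "us' @ vs' \<in> permutations_of_set A"
        and eq: "us @ y # vs = us' @ y # vs'"
      then have "y \<notin> set us" "y \<notin> set vs"
        using assms by (auto simp: permutations_of_set_def)
      then show "us = us' \<and> vs = vs'"
        using eq by (simp add: append_Cons_eq_iff)
    qed
    show "?h ` ?S = permutations_of_set (insert y A)"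
    proof (intro equalityI subsetI)
      fix ys assume ys: "ys \<in> permutations_of_set (insert y A)"
      then obtain us vs where "ys = us @ y # vs"
        by (metis insertI1 permutations_of_setD(1) split_list)
      with ys assms have "(us, vs) \<in> ?S"
        by (auto simp: permutations_of_set_def)
      with \<open>ys = us @ y # vs\<close> show "ys \<in> ?h ` ?S"
        by (auto simp: image_iff)
    qed (use assms in \<open>auto simp: permutations_of_set_def\<close>)
  qed
  show ?thesis
    unfolding sum_permutations_splits sum.reindex_bij_betw[OF bij, symmetric]
    by (intro sum.cong refl) auto
qed

text \<open>Cutting an ordering of \<open>A\<close> in two amounts to choosing the set
  \<open>B\<close> of its first part and ordering \<open>B\<close> and \<open>A - B\<close>
  independently.\<close>

lemma sum_permutations_splits_Pow:
  assumes "finite A"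
  shows "(\<Sum>zs\<in>permutations_of_set A. \<Sum>(us, vs)\<in>splits zs. f us vs) =
    (\<Sum>B\<in>Pow A. \<Sum>us\<in>permutations_of_set B. \<Sum>vs\<in>permutations_of_set (A - B). f us vs)"
proof -
  have "{(us, vs). us @ vs \<in> permutations_of_set A} =
      (\<Union>B\<in>Pow A. permutations_of_set B \<times> permutations_of_set (A - B))"
    by (fastforce simp: permutations_of_set_def)
  then show ?thesis
    unfolding sum_permutations_splits
    using assms
    by (simp add: sum.cartesian_product, subst sum.UNION_disjoint)
       (simp_all add: finite_subset, auto simp: permutations_of_set_def)
qed

text \<open>The terms \<open>B = {}\<close> and \<open>B = A\<close> vanish because
  \<open>path_prod x [] = 0\<close>. For empty \<open>A\<close> the left side would be 1 and the
  right side 0.\<close>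

lemma path_sum_insert:
  assumes "finite A" "A \<noteq> {}" "y \<notin> A" "inj_on x (insert y A)"
  shows "path_sum x (insert y A) = - (\<Sum>B\<in>Pow A. path_sum x B * path_sum x (A - B))"
proof -
  have "path_sum x (insert y A) =
      (\<Sum>zs\<in>permutations_of_set A. - (\<Sum>(us, vs)\<in>splits zs. path_prod x us * path_prod x vs))"
    unfolding path_sum_def sum_permutations_insert[OF assms(3)]
    by (intro sum.cong refl sum_insertions) (use assms in \<open>auto simp: permutations_of_set_def\<close>)
  also have "\<dots> = - (\<Sum>B\<in>Pow A. path_sum x B * path_sum x (A - B))"
    by (simp add: sum_negf sum_permutations_splits_Pow[OF assms(1)] path_sum_def sum_product)
  finally show ?thesis .
qed

text \<open>With exponential generating function P this recursion says P' = 1 - P^2 and P(0) = 0, so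
  P = tanh. The case \<open>m = 0\<close> supplies the constant 1.\<close>

fun path_number :: "nat \<Rightarrow> int" where
  "path_number 0 = 0"
| "path_number (Suc m) = (if m = 0 then 1 else
    - (\<Sum>k\<le>m. of_nat (m choose k) * (path_number k * path_number (m - k))))"

lemma sum_Pow_card:
  fixes f :: "nat \<Rightarrow> 'a::comm_ring_1"
  assumes "finite A"
  shows "(\<Sum>B\<in>Pow A. f (card B)) = (\<Sum>k\<le>card A. of_nat (card A choose k) * f k)"
proof -
  have "(\<Sum>B\<in>Pow A. f (card B)) = (\<Sum>k\<le>card A. \<Sum>B | B \<in> Pow A \<and> card B = k. f (card B))"
    using assms by (intro sum.group[symmetric]) (auto intro: card_mono)
  also have "\<dots> = (\<Sum>k\<le>card A. of_nat (card A choose k) * f k)"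
    using assms by (intro sum.cong refl) (simp add: n_subsets)
  finally show ?thesis .
qed

lemma path_sum_eq_path_number:
  fixes x :: "'i \<Rightarrow> 'a::field"
  assumes "finite A" "inj_on x A"
  shows "path_sum x A = of_int (path_number (card A))"
  using assms
proof (induction A rule: finite_psubset_induct)
  case (psubset A)
  show ?case
  proof (cases "A = {}")
    case True
    then show ?thesis by (simp add: path_sum_def)
  next
    case False
    then obtain y C where A: "A = insert y C" "y \<notin> C"
      by (metis ex_in_conv mk_disjoint_insert)
    with psubset have C: "finite C" by simp
    show ?thesis
    proof (cases "C = {}")
      case True
      then show ?thesis by (simp add: A path_sum_def)
    next
      case False
      have "path_sum x B * path_sum x (C - B) =
          of_int (path_number (card B) * path_number (card C - card B))" if "B \<in> Pow C" for B
      proof -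
        \<comment> \<open>Both parts miss \<open>y\<close>, so the induction hypothesis applies to
          each, even when one of them is all of \<open>C\<close>.\<close>
        have "B \<subset> A" "C - B \<subset> A"
          using that A by auto
        moreover have "card (C - B) = card C - card B"
          using that C by (simp add: card_Diff_subset finite_subset)
        ultimately show ?thesis
          using psubset by (metis inj_on_subset of_int_mult psubset_imp_subset)
      qed
      then have "(\<Sum>B\<in>Pow C. path_sum x B * path_sum x (C - B)) =
          (\<Sum>B\<in>Pow C. of_int (path_number (card B) * path_number (card C - card B)))"
        by (intro sum.cong refl)
      then have "path_sum x A =
          - (\<Sum>B\<in>Pow C. of_int (path_number (card B) * path_number (card C - card B)))"
        using path_sum_insert[OF C False A(2), of x] psubset.prems A(1) by metis
      also have "\<dots> = of_int (path_number (Suc (card C)))"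
        using C False sum_Pow_card[OF C, of "\<lambda>k. of_int (path_number k * path_number (card C - k)) :: 'a"]
        by simp
      finally show ?thesis
        using A C by simp
    qed
  qed
qed

section \<open>Cycles\<close>

lemma permutations_of_set_rotate1:
  "bij_betw rotate1 (permutations_of_set A) (permutations_of_set A)"
  unfolding bij_betw_def
proof
  show inj: "inj_on rotate1 (permutations_of_set A)"
  proof (rule inj_onI)
    fix zs ws :: "'a list" assume "rotate1 zs = rotate1 ws"
    then show "zs = ws" by (cases zs; cases ws) auto
  qed
  have "rotate1 ` permutations_of_set A \<subseteq> permutations_of_set A"
    by (auto simp: permutations_of_set_def)
  then show "rotate1 ` permutations_of_set A = permutations_of_set A"
    using inj by (intro endo_inj_surj) auto
qed

text \<open>Either side is the product around the closed cycle through \<open>zs\<close>; rotation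
  only changes which edge closes it.\<close>

lemma path_prod_rotate1:
  assumes "length zs \<ge> 2"
  shows "ratio x (last (rotate1 zs)) (hd (rotate1 zs)) * path_prod x (rotate1 zs) =
    ratio x (last zs) (hd zs) * path_prod x zs"
proof -
  obtain z w ws where "zs = z # w # ws"
    using assms by (cases zs; cases "tl zs") auto
  then show ?thesis
    using path_prod_append[of "w # ws" "[z]" x] by (simp add: mult_ac)
qed

text \<open>The three-term identity is applied to the two edges at \<open>y\<close>, whose other
  ends are the last and the first element of \<open>zs\<close>. Two elements are required to keep
  these ends distinct.\<close>

lemma sum_closed_paths:
  fixes x :: "'i \<Rightarrow> 'a::field"
  assumes "finite A" "card A \<ge> 2" "y \<notin> A" "inj_on x (insert y A)"
  shows "(\<Sum>zs\<in>permutations_of_set A. path_prod x (y # zs @ [y])) = - path_sum x A"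
proof -
  let ?P = "permutations_of_set A"
  \<comment> \<open>The product around the cycle that closes \<open>zs\<close> without passing
    through \<open>y\<close>.\<close>
  define c where "c = (\<lambda>zs. ratio x (last zs) (hd zs) * path_prod x zs)"
  have len: "length zs \<ge> 2" if "zs \<in> ?P" for zs
    using that assms by (simp add: length_finite_permutations_of_set)
  have eq: "path_prod x (y # zs @ [y]) =
      c zs * ratio x y (hd zs) - c zs * ratio x y (last zs) - path_prod x zs" if P: "zs \<in> ?P" for zs
  proof -
    obtain z w ws where zs: "zs = z # w # ws"
      using len[OF P] by (cases zs; cases "tl zs") auto
    have "last zs \<noteq> hd zs" and mem: "last zs \<in> A" "hd zs \<in> A"
      using P by (auto simp: zs permutations_of_set_def)
    with assms have ne: "x (last zs) \<noteq> x y" "x y \<noteq> x (hd zs)" "x (last zs) \<noteq> x (hd zs)"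
      by (auto simp: inj_on_def)
    have "path_prod x (y # zs @ [y]) =
        (ratio x (last zs) y * ratio x y (hd zs)) * path_prod x zs"
      using path_prod_append[of zs "[y]" x] by (simp add: zs mult_ac)
    also have "\<dots> = c zs * ratio x y (hd zs) - c zs * ratio x y (last zs) - path_prod x zs"
      unfolding ratio_three_term[of x "last zs" y "hd zs", OF ne] c_def
      by (simp add: ratio_swap[of x "last zs" y] algebra_simps)
    finally show ?thesis .
  qed
  \<comment> \<open>Rotation preserves \<open>c\<close> and moves the head to the end, so the sums
    over last and over first elements agree.\<close>
  have "(\<Sum>zs\<in>?P. c zs * ratio x y (last zs)) = (\<Sum>zs\<in>?P. c (rotate1 zs) * ratio x y (last (rotate1 zs)))"
    by (rule sum.reindex_bij_betw[OF permutations_of_set_rotate1, symmetric])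
  also have "\<dots> = (\<Sum>zs\<in>?P. c zs * ratio x y (hd zs))"
  proof (rule sum.cong)
    fix zs assume zs: "zs \<in> ?P"
    then have "last (rotate1 zs) = hd zs"
      using len[of zs] by (cases zs) auto
    then show "c (rotate1 zs) * ratio x y (last (rotate1 zs)) = c zs * ratio x y (hd zs)"
      using path_prod_rotate1[OF len[OF zs], of x] by (simp add: c_def)
  qed simp
  finally show ?thesis
    by (simp add: eq sum_subtractf path_sum_def)
qed

lemma map_cycle_of_list: "distinct zs \<Longrightarrow> map (cycle_of_list zs) zs = rotate1 zs"
  using cyclic_rotation[of zs 1] by simp

text \<open>A full cycle has exactly one cycle notation that starts with \<open>y\<close>.\<close>

lemma full_cycles_insert:
  assumes "{1..m} = insert y A" "y \<notin> A"
  shows "bij_betw (\<lambda>zs. cycle_of_list (y # zs)) (permutations_of_set A) (full_cycles m)"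
  unfolding bij_betw_def
proof
  show "inj_on (\<lambda>zs. cycle_of_list (y # zs)) (permutations_of_set A)"
  proof (rule inj_onI)
    fix zs zs' assume zs: "zs \<in> permutations_of_set A" "zs' \<in> permutations_of_set A"
      and eq: "cycle_of_list (y # zs) = cycle_of_list (y # zs')"
    \<comment> \<open>The ordering is recovered from the cycle as the successive images of
      \<open>y\<close>.\<close>
    have orbit: "zs = map (\<lambda>k. (cycle_of_list (y # zs) ^^ Suc k) y) [0..<card A]"
      if "zs \<in> permutations_of_set A" for zs
    proof (rule nth_equalityI)
      have d: "distinct (y # zs)" and len: "length zs = card A"
        using that assms by (auto simp: permutations_of_set_def distinct_card)
      show "length zs = length (map (\<lambda>k. (cycle_of_list (y # zs) ^^ Suc k) y) [0..<card A])"
        by (simp add: len)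
      fix k assume k: "k < length zs"
      have "map (cycle_of_list (y # zs) ^^ Suc k) (y # zs) ! 0 = rotate (Suc k) (y # zs) ! 0"
        by (subst cyclic_rotation[OF d]) simp
      also have "\<dots> = zs ! k"
        using k by (subst nth_rotate) auto
      finally show "zs ! k = map (\<lambda>k. (cycle_of_list (y # zs) ^^ Suc k) y) [0..<card A] ! k"
        using k len by simp
    qed
    show "zs = zs'"
      using orbit[OF zs(1)] orbit[OF zs(2)] eq by simp
  qed
  show "(\<lambda>zs. cycle_of_list (y # zs)) ` permutations_of_set A = full_cycles m"
  proof (intro equalityI subsetI)
    fix f assume "f \<in> (\<lambda>zs. cycle_of_list (y # zs)) ` permutations_of_set A"
    then obtain zs where "zs \<in> permutations_of_set A" "f = cycle_of_list (y # zs)" by blast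
    then show "f \<in> full_cycles m"
      using assms unfolding full_cycles_def permutations_of_set_def
      by (intro CollectI exI[of _ "y # zs"]) auto
  next
    fix f assume "f \<in> full_cycles m"
    then obtain as where as: "f = cycle_of_list as" "distinct as" "set as = insert y A"
      using assms by (auto simp: full_cycles_def)
    then obtain us vs where uv: "as = us @ y # vs"
      by (metis insertI1 split_list)
    \<comment> \<open>Rotating the list brings \<open>y\<close> to the front without changing the
      cycle.\<close>
    have "f = cycle_of_list (rotate (length us) as)"
      using as cycle_of_list_rotate_independent by blast
    also have "rotate (length us) as = y # vs @ us"
      by (simp add: uv rotate_append)
    finally have "f = cycle_of_list (y # vs @ us)" .
    moreover have "vs @ us \<in> permutations_of_set A"
      using as(2,3) assms(2) by (auto simp: uv permutations_of_set_def)
    ultimately show "f \<in> (\<lambda>zs. cycle_of_list (y # zs)) ` permutations_of_set A"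
      by blast
  qed
qed

lemma prod_list_shift:
  "prod_list (map2 (ratio x) (z # zs) (zs @ [y])) = path_prod x (z # zs @ [y])"
  by (induction zs arbitrary: z) auto

lemma prod_cycle_of_list:
  assumes "distinct (y # zs)" "zs \<noteq> []"
  shows "(\<Prod>j | j \<in> set (y # zs) \<and> cycle_of_list (y # zs) j \<noteq> j. ratio x j (cycle_of_list (y # zs) j)) =
    path_prod x (y # zs @ [y])"
proof -
  let ?f = "cycle_of_list (y # zs)"
  have shift: "map ?f (y # zs) = zs @ [y]"
    using map_cycle_of_list[OF assms(1)] by simp
  have "?f j \<noteq> j" if j: "j \<in> set (y # zs)" for j
  proof -
    \<comment> \<open>Position \<open>k\<close> is sent to position \<open>k + 1\<close> modulo the
      length, which differs from \<open>k\<close> because the length is at least 2.\<close>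
    obtain k where k: "k < length (y # zs)" "j = (y # zs) ! k"
      using j by (metis in_set_conv_nth)
    have "?f j = rotate1 (y # zs) ! k"
      unfolding k(2) map_cycle_of_list[OF assms(1), symmetric] using k(1) by (rule nth_map[symmetric])
    also have "\<dots> = (y # zs) ! (Suc k mod length (y # zs))"
      using k(1) by (rule nth_rotate1)
    also have "\<dots> \<noteq> (y # zs) ! k"
      using assms k(1) by (subst nth_eq_iff_index_eq[OF assms(1)]) (auto simp: mod_Suc)
    finally show ?thesis by (simp add: k(2))
  qed
  then have "{j. j \<in> set (y # zs) \<and> ?f j \<noteq> j} = set (y # zs)"
    by blast
  then have "(\<Prod>j | j \<in> set (y # zs) \<and> ?f j \<noteq> j. ratio x j (?f j)) =
      prod_list (map (\<lambda>j. ratio x j (?f j)) (y # zs))"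
    by (simp only: prod.distinct_set_conv_list[OF assms(1)])
  also have "\<dots> = prod_list (map2 (ratio x) (y # zs) (map ?f (y # zs)))"
    by (simp add: zip_map2 zip_same_conv_map comp_def)
  also have "\<dots> = path_prod x (y # zs @ [y])"
    unfolding shift by (rule prod_list_shift)
  finally show ?thesis .
qed

lemma cycle_sum_eq_path_number:
  fixes x :: "nat \<Rightarrow> 'a::field"
  assumes "n > 1" "inj_on x {1..2 * n}"
  shows "cycle_sum n x = - of_int (path_number (2 * n - 1))"
proof -
  \<comment> \<open>Every cycle is written starting from \<open>2 * n\<close>. The rest has
    \<open>2 * n - 1\<close> elements, and \<open>n > 1\<close> makes this at least 2, as
    \<open>sum_closed_paths\<close> demands.\<close>
  define A where "A = {1..2 * n - 1}"
  have A: "{1..2 * n} = insert (2 * n) A" "2 * n \<notin> A" "finite A" "card A = 2 * n - 1"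
    using assms(1) by (auto simp: A_def)
  have "cycle_sum n x = (\<Sum>zs\<in>permutations_of_set A.
      \<Prod>j\<in>{j \<in> {1..2 * n}. cycle_of_list (2 * n # zs) j \<noteq> j}. ratio x j (cycle_of_list (2 * n # zs) j))"
    unfolding cycle_sum_def ratio_def
    by (rule sum.reindex_bij_betw[OF full_cycles_insert[OF A(1,2)], symmetric])
  also have "\<dots> = (\<Sum>zs\<in>permutations_of_set A. path_prod x (2 * n # zs @ [2 * n]))"
  proof (rule sum.cong)
    fix zs assume zs: "zs \<in> permutations_of_set A"
    then have "distinct (2 * n # zs)" "{1..2 * n} = set (2 * n # zs)"
      using A by (auto simp: permutations_of_set_def)
    moreover have "zs \<noteq> []"
      using zs A assms(1) by (auto simp: permutations_of_set_def)
    ultimately show "(\<Prod>j\<in>{j \<in> {1..2 * n}. cycle_of_list (2 * n # zs) j \<noteq> j}.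
        ratio x j (cycle_of_list (2 * n # zs) j)) = path_prod x (2 * n # zs @ [2 * n])"
      by (simp only: prod_cycle_of_list not_False_eq_True)
  qed simp
  also have "\<dots> = - path_sum x A"
    using A assms by (intro sum_closed_paths) auto
  also have "\<dots> = - of_int (path_number (2 * n - 1))"
    using A assms by (subst path_sum_eq_path_number) (auto intro: inj_on_subset)
  finally show ?thesis .
qed

section \<open>Tangent numbers\<close>

text \<open>Multiplied by the nonzero series cos^2, both sides become 1.\<close>

lemma fps_tan_deriv_eq: "fps_deriv (fps_tan (1::real)) = 1 + (fps_tan 1)\<^sup>2"
proof -
  let ?s = "fps_sin (1::real)" and ?c = "fps_cos (1::real)"
  have c0: "fps_nth ?c 0 \<noteq> 0" by (simp add: fps_cos_def)
  then have "?c \<noteq> 0" by (metis fps_zero_nth)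
  then have ne: "?c\<^sup>2 \<noteq> 0" by simp
  have "fps_tan 1 * ?c = ?s"
    using c0 by (simp add: fps_tan_def fps_divide_unit mult.assoc inverse_mult_eq_1)
  then have "(1 + (fps_tan 1)\<^sup>2) * ?c\<^sup>2 = 1"
    using fps_sin_cos_sum_of_squares[of "1::real"]
    by (simp add: algebra_simps flip: power_mult_distrib)
  moreover have "fps_deriv (fps_tan 1) * ?c\<^sup>2 = 1"
    using c0 by (simp add: fps_tan_deriv fps_divide_unit fps_nth_power_0 inverse_mult_eq_1)
  ultimately show ?thesis
    using ne by (metis mult_right_cancel)
qed

definition tan_coeff :: "nat \<Rightarrow> real" where
  "tan_coeff m = fact m * fps_nth (fps_tan 1) m"

lemma tan_coeff_0: "tan_coeff 0 = 0"
  by (simp add: tan_coeff_def fps_tan_def fps_sin_def fps_cos_def)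

text \<open>Coefficients are compared in tan' = 1 + tan^2; the factorials turn the Cauchy product
  into a binomial convolution.\<close>

lemma tan_coeff_Suc:
  "tan_coeff (Suc m) =
    (if m = 0 then 1 else 0) + (\<Sum>k\<le>m. of_nat (m choose k) * (tan_coeff k * tan_coeff (m - k)))"
proof -
  let ?F = "fps_tan (1::real)"
  have "real (Suc m) * fps_nth ?F (Suc m) =
      (if m = 0 then 1 else 0) + (\<Sum>k\<le>m. fps_nth ?F k * fps_nth ?F (m - k))"
    using arg_cong[OF fps_tan_deriv_eq, of "\<lambda>G. fps_nth G m"]
    by (simp add: power2_eq_square fps_mult_nth atLeast0AtMost)
  then have "tan_coeff (Suc m) =
      fact m * ((if m = 0 then 1 else 0) + (\<Sum>k\<le>m. fps_nth ?F k * fps_nth ?F (m - k)))"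
    unfolding tan_coeff_def fact_Suc by (metis mult.assoc mult.commute of_nat_mult)
  also have "\<dots> = (if m = 0 then 1 else 0) +
      (\<Sum>k\<le>m. fact m * (fps_nth ?F k * fps_nth ?F (m - k)))"
    by (simp add: sum_distrib_left distrib_left)
  also have "(\<Sum>k\<le>m. fact m * (fps_nth ?F k * fps_nth ?F (m - k))) =
      (\<Sum>k\<le>m. of_nat (m choose k) * (tan_coeff k * tan_coeff (m - k)))"
    by (intro sum.cong refl) (simp add: tan_coeff_def binomial_fact)
  finally show ?thesis .
qed

text \<open>For even \<open>m = Suc l\<close> the number \<open>l\<close> is odd, so
  \<open>k\<close> or \<open>l - k\<close> is even and each product vanishes by induction; the
  constant 1 appears only for \<open>l = 0\<close>.\<close>

lemma tan_coeff_even: "even m \<Longrightarrow> tan_coeff m = 0"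
proof (induction m rule: less_induct)
  case (less m)
  show ?case
  proof (cases m)
    case (Suc l)
    then have "tan_coeff k * tan_coeff (l - k) = 0" if "k \<le> l" for k
      using that less by (cases "even k") auto
    then have "(\<Sum>k\<le>l. of_nat (l choose k) * (tan_coeff k * tan_coeff (l - k))) = 0"
      by (intro sum.neutral) simp
    moreover have "l \<noteq> 0"
      using Suc less.prems by (metis even_Suc odd_pos less_irrefl)
    ultimately show ?thesis
      by (simp add: Suc tan_coeff_Suc)
  qed (simp add: tan_coeff_0)
qed

text \<open>This is tanh x = -i tan (i x) read off coefficientwise, proved by comparing the two
  recursions.\<close>

lemma path_number_eq: "of_int (path_number m) = (-1) ^ (m div 2) * tan_coeff m"
proof (induction m rule: less_induct)
  case (less m)
  show ?case
  proof (cases m)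
    case (Suc l)
    \<comment> \<open>For odd \<open>k\<close> and \<open>l - k\<close>, \<open>m div 2\<close>
      exceeds the sum of their halves by one, which accounts for the minus sign. Otherwise an even
      index makes both sides zero.\<close>
    have sign: "of_int (path_number k * path_number (l - k)) =
        - ((-1) ^ (m div 2)) * (tan_coeff k * tan_coeff (l - k))" if "k \<le> l" for k
    proof (cases "odd k \<and> odd (l - k)")
      case True
      then obtain a b where ab: "k = 2 * a + 1" "l - k = 2 * b + 1"
        by (meson oddE)
      then have "m = 2 * (a + b + 1) + 1"
        using that Suc by simp
      then have "m div 2 = a + b + 1" by presburger
      moreover have "k div 2 = a" "(l - k) div 2 = b"
        using ab by auto
      ultimately show ?thesis
        using less[of k] less[of "l - k"] Suc that by (simp add: power_add)
    next
      case False
      then show ?thesis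
        using less[of k] less[of "l - k"] Suc that by (auto simp: tan_coeff_even)
    qed
    show ?thesis
    proof (cases "l = 0")
      case False
      then have "of_int (path_number m) =
          - (\<Sum>k\<le>l. of_nat (l choose k) * (of_int (path_number k * path_number (l - k)) :: real))"
        by (simp add: Suc)
      also have "\<dots> = (-1) ^ (m div 2) * (\<Sum>k\<le>l. of_nat (l choose k) * (tan_coeff k * tan_coeff (l - k)))"
        unfolding sum_distrib_left sum_negf[symmetric]
        by (intro sum.cong refl) (subst sign, simp_all)
      finally show ?thesis
        using False by (simp add: Suc tan_coeff_Suc)
    qed (simp add: Suc tan_coeff_Suc tan_coeff_0)
  qed (simp add: tan_coeff_0)
qed

text \<open>Here \<open>(2 * n - 1) div 2 = n - 1\<close>, and the extra minus sign raises the
  exponent to \<open>n\<close>.\<close>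

lemma path_number_odd:
  assumes "n \<ge> 1"
  shows "of_int (- path_number (2 * n - 1)) = (-1) ^ n * tangent_number n"
proof -
  obtain l where "n = Suc l"
    using assms by (cases n) auto
  then show ?thesis
    using path_number_eq[of "2 * n - 1"] tan_expansion_unique[OF tan_expansion_tangent_number assms]
    by (simp add: tan_coeff_def)
qed

section \<open>Rational functions\<close>

text \<open>Ensures that the denominators in the cycle sum are nonzero. Taking keys twice recovers
  the index from the monomial.\<close>

lemma inj_indet: "inj indet"
  by (auto simp: inj_def indet_def eq_fract lookup_single when_def
        dest!: arg_cong[of _ _ Poly_Mapping.keys] split: if_splits)

lemma scalar_of_nat: "scalar (of_nat k) = of_nat k"
  by (simp add: scalar_def flip: of_nat_fract)

lemma scalar_uminus: "scalar (- a) = - scalar a"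
  by (simp add: scalar_def single_uminus)

lemma scalar_of_int: "scalar (of_int k) = of_int k"
  by (cases k rule: int_cases2) (simp_all add: scalar_of_nat scalar_uminus)

theorem theorem1p2:
  fixes n :: nat
  assumes "n > 1"
  shows "cycle_sum n indet = scalar ((-1) ^ n * tangent_number n)"
proof -
  \<comment> \<open>The evaluation holds for any injective family in any field; here it is
    specialised to the indeterminates.\<close>
  have "cycle_sum n indet = of_int (- path_number (2 * n - 1))"
    using assms inj_indet by (subst cycle_sum_eq_path_number) (auto intro: inj_on_subset)
  then show ?thesis
    using path_number_odd[of n] assms by (metis less_imp_le scalar_of_int)
qed

end
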